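(* Let $2\le m<n$, let $A\in\mathbb{C}^{n\times n}$ be skew-Hermitian with ordered orthonormal eigenvectors $v_1,\dots,v_n$, let $B\in\mathbb{C}^{n\times m}$, and let $\Pi_k$ ($1\le k\le n-m+1$) be the orthogonal projection of $\mathbb{C}^n$ onto the linear span of $v_k,\dots,v_{k+m-1}$. Assume that positive constants $\gamma$, $K$ satisfy (i) $\|B\|\le K$; (ii) $\|B^*\Pi_kd\|\ge\gamma\|\Pi_kd\|$ for all $d\in\mathbb{C}^n$ and all $k=1,\dots,n-m+1$. Let $\Delta_m=\min_{1\le j\le n-m}|\lambda_{j+m}-\lambda_j|$, let $\sigma_0=\sigma_0\bigl(\frac{K^2}{\gamma^2}\bigr)$, and put $$\rho=\frac12\min\left\{\Delta_m\Bigl(2\,\frac{\sigma_0^{m+1}-1}{\sigma_0-1}-1\Bigr)^{-1/2},\ \gamma\Bigl[\mu\Bigl(\frac{K^2}{\gamma^2}\Bigr)\Bigr]^{1/2}\right\},$$ where the functions $\sigma_0(\cdot)$ and $\mu(\cdot)$ are defined in the context. Then all eigenvalues of the closed-loop matrix $A_{\mathrm{cl.loop}}$ lie in the half-plane $\operatorname{Re} z\le-\rho<0$.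
   Context: Definition of $\sigma_0(\theta)$ and $\mu(\theta)$: for $\theta>0$ let $f(\sigma)=\dfrac{\sigma-\theta}{\sigma+\sigma^2+\dots+\sigma^{m+1}}$ on $(\theta,+\infty)$ (positive there, vanishing at $\theta$ and at $+\infty$). $\sigma_0(\theta)$ is the (unique) point of $(\theta,+\infty)$ where $f$ attains its maximal value, and $\mu(\theta)=f(\sigma_0(\theta))$. Setting: $A\in\mathbb{C}^{n\times n}$ is skew-Hermitian ($A^*=-A$), with eigenvalues (listed with multiplicity; coincidences are allowed) $i\lambda_1,\dots,i\lambda_n$, $\lambda_1\le\dots\le\lambda_n$ real, and $v_1,\dots,v_n$ an orthonormal basis of $\mathbb{C}^n$ with $Av_j=i\lambda_jv_j$. $B\in\mathbb{C}^{n\times m}$ has $\ker B=\{0\}$ and the pair $(A,B)$ is stabilizable (equivalently, controllable; this forces $\Delta_m>0$). $\|\cdot\|$ is the Euclidean norm of vectors and the induced operator norm. Linear quadratic regulator: for $x'(t)=Ax(t)+Bu(t)$, $x(0)=x_0$, minimize $\int_0^\infty x(t)^*x(t)+u(t)^*u(t)\,dt$. The optimal control is $u=-B^*Xx$, where $X$ is the unique nonnegative (in fact positive definite) solution of $XBB^*X-XA-A^*X-I=0$, and $A_{\mathrm{cl.loop}}=A-BB^*X$, which is stable. *)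

theory Defs
  imports "HOL-Analysis.Analysis"
begin

text \<open>The library inner product on \<^typ>\<open>complex ^ 'n\<close> is the real-valued one, so the Hermitian
  product \<open>x\<^sup>* y\<close> (conjugate-linear in the first argument) is introduced here.  The library norm on
  \<^typ>\<open>complex ^ 'n\<close> is already the Euclidean norm belonging to it, and the induced operator norm of a
  matrix \<open>M\<close> is \<open>onorm ((*v) M)\<close>.\<close>

definition cinner :: "complex ^ 'n \<Rightarrow> complex ^ 'n \<Rightarrow> complex" where
  "cinner x y = (\<Sum>i\<in>UNIV. cnj (x $ i) * y $ i)"

definition conj_transpose :: "complex ^ 'm ^ 'n \<Rightarrow> complex ^ 'n ^ 'm" where
  "conj_transpose M = map_matrix cnj (transpose M)"

definition skew_hermitian :: "complex ^ 'n ^ 'n \<Rightarrow> bool" where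
  "skew_hermitian A \<longleftrightarrow> conj_transpose A = - A"

definition nonneg_definite :: "complex ^ 'n ^ 'n \<Rightarrow> bool" where
  "nonneg_definite X \<longleftrightarrow> conj_transpose X = X \<and> (\<forall>x. 0 \<le> Re (cinner x (X *v x)))"

definition matrix_eigenvalue :: "complex ^ 'n ^ 'n \<Rightarrow> complex \<Rightarrow> bool" where
  "matrix_eigenvalue M z \<longleftrightarrow> (\<exists>w. w \<noteq> 0 \<and> M *v w = z *s w)"

definition orthonormal_basis :: "nat set \<Rightarrow> (nat \<Rightarrow> complex ^ 'n) \<Rightarrow> bool" where
  "orthonormal_basis J v \<longleftrightarrow>
     (\<forall>j\<in>J. \<forall>k\<in>J. cinner (v j) (v k) = (if j = k then 1 else 0)) \<and> vec.span (v ` J) = UNIV"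

text \<open>Here \<^const>\<open>vec.span\<close> is the span over the complex scalars.  For a complex subspace \<open>S\<close> the
  vector \<open>p\<close> below exists and is unique.\<close>

definition orth_proj :: "(complex ^ 'n) set \<Rightarrow> complex ^ 'n \<Rightarrow> complex ^ 'n" where
  "orth_proj S d = (THE p. p \<in> S \<and> (\<forall>s\<in>S. cinner s (d - p) = 0))"

definition stable :: "complex ^ 'n ^ 'n \<Rightarrow> bool" where
  "stable M \<longleftrightarrow> (\<forall>z. matrix_eigenvalue M z \<longrightarrow> Re z < 0)"

definition stabilizable :: "complex ^ 'n ^ 'n \<Rightarrow> complex ^ 'm ^ 'n \<Rightarrow> bool" where
  "stabilizable A B \<longleftrightarrow> (\<exists>F :: complex ^ 'n ^ 'm. stable (A + B ** F))"

text \<open>The Riccati equation of the regulator problem with cost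
  \<open>\<integral>\<^sub>0\<^sup>\<infinity> x(t)\<^sup>* x(t) + u(t)\<^sup>* u(t) dt\<close>; its nonnegative solution \<open>X\<close> gives the optimal feedback
  \<open>u = - B\<^sup>* X x\<close>.\<close>

definition lqr_riccati :: "complex ^ 'n ^ 'n \<Rightarrow> complex ^ 'm ^ 'n \<Rightarrow> complex ^ 'n ^ 'n \<Rightarrow> bool" where
  "lqr_riccati A B X \<longleftrightarrow>
     X ** B ** conj_transpose B ** X - X ** A - conj_transpose A ** X - mat 1 = 0"

definition closed_loop ::
    "complex ^ 'n ^ 'n \<Rightarrow> complex ^ 'm ^ 'n \<Rightarrow> complex ^ 'n ^ 'n \<Rightarrow> complex ^ 'n ^ 'n" where
  "closed_loop A B X = A - B ** conj_transpose B ** X"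

definition eig_gap :: "nat \<Rightarrow> nat \<Rightarrow> (nat \<Rightarrow> real) \<Rightarrow> real" where
  "eig_gap n m l = (MIN j\<in>{1..n - m}. \<bar>l (j + m) - l j\<bar>)"

definition f_quot :: "nat \<Rightarrow> real \<Rightarrow> real \<Rightarrow> real" where
  "f_quot m \<theta> \<sigma> = (\<sigma> - \<theta>) / (\<Sum>i = 1..m + 1. \<sigma> ^ i)"

text \<open>For \<open>m \<ge> 1\<close> and \<open>\<theta> > 0\<close> the maximum over \<open>(\<theta>, \<infinity>)\<close> is attained at exactly one point.\<close>

definition sigma0 :: "nat \<Rightarrow> real \<Rightarrow> real" where
  "sigma0 m \<theta> = arg_max_on (f_quot m \<theta>) {\<theta><..}"

definition mu :: "nat \<Rightarrow> real \<Rightarrow> real" where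
  "mu m \<theta> = f_quot m \<theta> (sigma0 m \<theta>)"

end

theory Submission
  imports Defs
begin

text \<open>If \<open>w\<close> is an eigenvector of the closed loop with eigenvalue \<open>z\<close>, then \<open>y = X w\<close> solves
  \<open>(A - z)\<^sup>2 y = B B\<^sup>* y\<close>.  Pairing with \<open>y = \<Sum>\<^sub>j c\<^sub>j v\<^sub>j\<close> and writing \<open>r = Re z\<close>, \<open>s = Im z\<close> gives
  \<open>\<parallel>B\<^sup>* y\<parallel>\<^sup>2 = \<Sum>\<^sub>j (r\<^sup>2 - (\<lambda>\<^sub>j - s)\<^sup>2) \<bar>c\<^sub>j\<bar>\<^sup>2\<close>.  Some window of \<open>m\<close> consecutive indices contains every
  \<open>j\<close> with \<open>\<bar>\<lambda>\<^sub>j - s\<bar> < \<Delta>\<^sub>m / 2\<close>.  Let \<open>p\<close> be the part of \<open>y\<close> in that window and \<open>q = y - p\<close>.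
  With \<open>\<theta> = K\<^sup>2 / \<gamma>\<^sup>2 \<ge> 1\<close>, the bound \<open>\<sigma>\<^sub>0 > \<theta>\<close> already yields
  \<open>2 (\<sigma>\<^sub>0\<^sup>m\<^sup>+\<^sup>1 - 1) / (\<sigma>\<^sub>0 - 1) - 1 \<ge> 4 \<theta> + 1\<close> and \<open>\<mu>(\<theta>) < 1\<close>.  Hence \<open>\<bar>r\<bar> < \<rho>\<close> would force
  \<open>\<parallel>B\<^sup>* y\<parallel>\<^sup>2 \<le> r\<^sup>2 (\<parallel>p\<parallel>\<^sup>2 - 4 \<theta> \<parallel>q\<parallel>\<^sup>2)\<close>, so \<open>K \<parallel>q\<parallel> \<le> \<gamma> \<parallel>p\<parallel> / 2\<close> and therefore
  \<open>\<gamma> \<parallel>p\<parallel> / 2 \<le> \<gamma> \<parallel>p\<parallel> - K \<parallel>q\<parallel> \<le> \<parallel>B\<^sup>* y\<parallel> \<le> \<bar>r\<bar> \<parallel>p\<parallel>\<close>, contradicting \<open>2 \<bar>r\<bar> < \<gamma>\<close>.\<close>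

section \<open>Hermitian product and adjoint\<close>

lemma Re_cinner: "Re (cinner x y) = x \<bullet> y"
  by (simp add: cinner_def inner_vec_def inner_complex_def)

lemma cinner_add_left: "cinner (x + y) z = cinner x z + cinner y z"
  by (simp add: cinner_def algebra_simps sum.distrib)

lemma cinner_add_right: "cinner z (x + y) = cinner z x + cinner z y"
  by (simp add: cinner_def algebra_simps sum.distrib)

lemma cinner_diff_right: "cinner z (x - y) = cinner z x - cinner z y"
  by (simp add: cinner_def algebra_simps sum_subtractf)

lemma cinner_minus_right: "cinner x (- y) = - cinner x y"
  by (simp add: cinner_def sum_negf)

lemma cinner_scale_left: "cinner (c *s x) y = cnj c * cinner x y"
  by (simp add: cinner_def sum_distrib_left algebra_simps)

lemma cinner_scale_right: "cinner x (c *s y) = c * cinner x y"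
  by (simp add: cinner_def sum_distrib_left algebra_simps)

lemma cinner_zero_left [simp]: "cinner 0 x = 0"
  by (simp add: cinner_def)

lemma cinner_zero_right [simp]: "cinner x 0 = 0"
  by (simp add: cinner_def)

lemma cinner_sum_left: "cinner (\<Sum>i\<in>I. f i) x = (\<Sum>i\<in>I. cinner (f i) x)"
  by (induction I rule: infinite_finite_induct) (auto simp: cinner_add_left)

lemma cinner_sum_right: "cinner x (\<Sum>i\<in>I. f i) = (\<Sum>i\<in>I. cinner x (f i))"
  by (induction I rule: infinite_finite_induct) (auto simp: cinner_add_right)

lemma cinner_self: "cinner x x = of_real ((norm x)\<^sup>2)"
proof -
  have "Im (cinner x x) = 0"
    by (simp add: cinner_def)
  moreover have "Re (cinner x x) = (norm x)\<^sup>2"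
    by (simp add: Re_cinner power2_norm_eq_inner)
  ultimately show ?thesis
    by (simp add: complex_eq_iff)
qed

lemma conj_transpose_nth [simp]: "conj_transpose M $ i $ j = cnj (M $ j $ i)"
  by (simp add: conj_transpose_def map_matrix_def transpose_def)

lemma conj_transpose_conj_transpose [simp]: "conj_transpose (conj_transpose M) = M"
  by (simp add: vec_eq_iff)

lemma cinner_adjoint: "cinner (M *v x) y = cinner x (conj_transpose M *v y)"
proof -
  have "cinner (M *v x) y = (\<Sum>i\<in>UNIV. \<Sum>j\<in>UNIV. cnj (M $ i $ j) * cnj (x $ j) * y $ i)"
    by (simp add: cinner_def matrix_vector_mult_def sum_distrib_right)
  also have "\<dots> = (\<Sum>j\<in>UNIV. \<Sum>i\<in>UNIV. cnj (M $ i $ j) * cnj (x $ j) * y $ i)"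
    by (rule sum.swap)
  also have "\<dots> = cinner x (conj_transpose M *v y)"
    by (simp add: cinner_def matrix_vector_mult_def sum_distrib_left algebra_simps)
  finally show ?thesis .
qed

lemma uminus_matrix_vector_mult: "(- M) *v x = - (M *v x)" for M :: "complex ^ 'n ^ 'm"
  using matrix_vector_mult_diff_rdistrib[of 0 M x] by simp

lemma mat_matrix_vector_mult: "mat z *v x = z *s x" for z :: complex
  by (simp add: vec_eq_iff matrix_vector_mult_def mat_def if_distrib[of "\<lambda>u. u * _"] cong: if_cong)

text \<open>With u = \<open>conj_transpose B *v y\<close>, Cauchy-Schwarz gives |u|^2 = Re <B u, y>
  <= K |u| |y|, and |u| cancels unless it is 0.\<close>

lemma norm_conj_transpose_mult_le:
  fixes B :: "complex ^ 'm ^ 'n"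
  assumes "onorm ((*v) B) \<le> K"
  shows "norm (conj_transpose B *v y) \<le> K * norm y"
proof -
  let ?u = "conj_transpose B *v y"
  have "norm (B *v ?u) \<le> onorm ((*v) B) * norm ?u"
    by (intro onorm matrix_vector_mul_bounded_linear)
  also have "\<dots> \<le> K * norm ?u"
    by (intro mult_right_mono assms norm_ge_zero)
  finally have le: "norm (B *v ?u) \<le> K * norm ?u" .
  have "(norm ?u)\<^sup>2 = Re (cinner (B *v ?u) y)"
    by (simp add: cinner_adjoint cinner_self)
  also have "\<dots> \<le> norm (B *v ?u) * norm y"
    by (simp add: Re_cinner norm_cauchy_schwarz)
  also have "\<dots> \<le> K * norm ?u * norm y"
    by (intro mult_right_mono le norm_ge_zero)
  finally have *: "norm ?u * norm ?u \<le> norm ?u * (K * norm y)"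
    by (simp add: power2_eq_square mult_ac)
  show ?thesis
  proof (cases "norm ?u = 0")
    case True
    have "0 \<le> K"
      using assms onorm_pos_le[OF matrix_vector_mul_bounded_linear, of B] by linarith
    then show ?thesis using True by simp
  next
    case False
    then show ?thesis
      using mult_le_cancel_left_pos[of "norm ?u"] * by auto
  qed
qed

section \<open>Orthogonal projections and orthonormal expansions\<close>

text \<open>A candidate p makes d - p an element of S orthogonal to itself. This turns hypothesis
  (ii) on projections into a lower bound for every vector of a window's span.\<close>

lemma orth_proj_fixes:
  assumes "vec.subspace S" "d \<in> S"
  shows "orth_proj S d = d"
  unfolding orth_proj_def
proof (rule the_equality)
  fix p assume p: "p \<in> S \<and> (\<forall>s\<in>S. cinner s (d - p) = 0)"
  then have "cinner (d - p) (d - p) = 0"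
    using assms vec.subspace_diff by blast
  then show "p = d"
    by (simp add: cinner_self)
qed (use assms in simp)

lemma orthonormal_basis_inj:
  assumes "orthonormal_basis J v"
  shows "inj_on v J"
  using assms unfolding orthonormal_basis_def inj_on_def by (metis zero_neq_one)

text \<open>A spanning set with as many elements as the dimension is independent; injectivity of v
  supplies the count.\<close>

lemma orthonormal_basis_independent:
  fixes v :: "nat \<Rightarrow> complex ^ 'n"
  assumes "orthonormal_basis {1..CARD('n)} v"
  shows "vec.independent (v ` {1..CARD('n)})"
proof -
  have "card (v ` {1..CARD('n)}) = vec.dim (UNIV :: (complex ^ 'n) set)"
    using card_image[OF orthonormal_basis_inj[OF assms]] by (simp add: vec_dim_card del: vec.dim_UNIV)
  then show ?thesis
    using vec.card_eq_dim[of "v ` {1..CARD('n)}" UNIV] assms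
    by (simp add: orthonormal_basis_def del: vec.dim_UNIV)
qed

lemma span_image_sumE:
  fixes v :: "'i \<Rightarrow> complex ^ 'n"
  assumes "finite J" "inj_on v J" "x \<in> vec.span (v ` J)"
  obtains c where "x = (\<Sum>j\<in>J. c j *s v j)"
proof -
  obtain u where "x = (\<Sum>b\<in>v ` J. u b *s b)"
    using assms by (auto simp: vec.span_finite)
  then have "x = (\<Sum>j\<in>J. u (v j) *s v j)"
    using assms by (simp add: sum.reindex)
  then show ?thesis by (rule that)
qed

lemma cinner_orthonormal_sums:
  assumes "finite J" "\<forall>j\<in>J. \<forall>k\<in>J. cinner (v j) (v k) = (if j = k then 1 else 0)"
  shows "cinner (\<Sum>j\<in>J. c j *s v j) (\<Sum>j\<in>J. d j *s v j) = (\<Sum>j\<in>J. cnj (c j) * d j)"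
proof -
  have "cinner (\<Sum>j\<in>J. c j *s v j) (\<Sum>j\<in>J. d j *s v j)
      = (\<Sum>j\<in>J. \<Sum>k\<in>J. cnj (c j) * d k * cinner (v j) (v k))"
    unfolding cinner_sum_left unfolding cinner_sum_right
    by (simp add: cinner_scale_left cinner_scale_right mult_ac)
  also have "\<dots> = (\<Sum>j\<in>J. \<Sum>k\<in>J. if j = k then cnj (c j) * d k else 0)"
    using assms by (intro sum.cong refl) auto
  also have "\<dots> = (\<Sum>j\<in>J. cnj (c j) * d j)"
    using assms(1) by (intro sum.cong refl) (auto simp: sum.delta)
  finally show ?thesis .
qed

lemma norm_orthonormal_sum:
  assumes "finite J" "\<forall>j\<in>J. \<forall>k\<in>J. cinner (v j) (v k) = (if j = k then 1 else 0)"
  shows "(norm (\<Sum>j\<in>J. c j *s v j))\<^sup>2 = (\<Sum>j\<in>J. (cmod (c j))\<^sup>2)"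
proof -
  have "complex_of_real ((norm (\<Sum>j\<in>J. c j *s v j))\<^sup>2) = (\<Sum>j\<in>J. cnj (c j) * c j)"
    using cinner_orthonormal_sums[OF assms, of c c] by (simp add: cinner_self)
  also have "\<dots> = of_real (\<Sum>j\<in>J. (cmod (c j))\<^sup>2)"
    by (simp add: complex_norm_square mult.commute del: of_real_power)
  finally show ?thesis
    using of_real_eq_iff by blast
qed

lemma shifted_apply_sum:
  fixes v :: "'i \<Rightarrow> complex ^ 'n"
  assumes "\<forall>j\<in>J. A *v v j = a j *s v j"
  shows "A *v (\<Sum>j\<in>J. c j *s v j) - z *s (\<Sum>j\<in>J. c j *s v j) = (\<Sum>j\<in>J. ((a j - z) * c j) *s v j)"
proof -
  have "A *v (\<Sum>j\<in>J. c j *s v j) = (\<Sum>j\<in>J. (a j * c j) *s v j)"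
    using assms by (simp add: vec.sum vec.scale mult.commute cong: sum.cong)
  moreover have "z *s (\<Sum>j\<in>J. c j *s v j) = (\<Sum>j\<in>J. (z * c j) *s v j)"
    by (simp add: vec.scale_sum_right)
  ultimately show ?thesis
    by (simp add: left_diff_distrib vec.scale_left_diff_distrib sum_subtractf)
qed

section \<open>Closed-loop eigenvectors and the Riccati equation\<close>

text \<open>Applying the Riccati equation to w and replacing the adjoint of A by -A leaves X applied
  to the closed-loop image of w, which is z X w. Eliminating w from the two conclusions yields the
  quadratic equation for X w.\<close>

lemma riccati_eigenvector:
  fixes A X :: "complex ^ 'n ^ 'n" and B :: "complex ^ 'm ^ 'n"
  assumes skew: "skew_hermitian A" and ric: "lqr_riccati A B X"
    and w: "closed_loop A B X *v w = z *s w"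
  shows "A *v (X *v w) - z *s (X *v w) = w"
    and "A *v w - z *s w = B *v (conj_transpose B *v (X *v w))"
proof -
  let ?g = "B *v (conj_transpose B *v (X *v w))"
  have cl: "A *v w - ?g = z *s w"
    using w by (simp add: closed_loop_def matrix_vector_mult_diff_rdistrib
        matrix_vector_mul_assoc matrix_mul_assoc)
  then show "A *v w - z *s w = ?g"
    by (simp add: algebra_simps)
  have "(X ** B ** conj_transpose B ** X - X ** A + A ** X - mat 1) *v w = 0"
  proof -
    have "conj_transpose A ** X = - (A ** X)"
      using skew by (simp add: skew_hermitian_def vec_eq_iff matrix_matrix_mult_def sum_negf)
    then show ?thesis
      using ric by (simp add: lqr_riccati_def)
  qed
  then have "X *v ?g - X *v (A *v w) + A *v (X *v w) - w = 0"
    by (simp add: matrix_vector_mult_diff_rdistrib matrix_vector_mult_add_rdistrib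
        matrix_vector_mul_assoc matrix_mul_assoc)
  moreover have "X *v (A *v w) - X *v ?g = z *s (X *v w)"
    using cl by (metis vec.diff vec.scale)
  ultimately show "A *v (X *v w) - z *s (X *v w) = w"
    by (simp add: algebra_simps)
qed

text \<open>A Lyapunov argument: pairing the first eigenvector equation with w gives |w|^2 + |b|^2 =
  -2 Re z <w, X w>, where b is the adjoint of B applied to X w. The left side is positive and <w, X
  w> has nonnegative real part.\<close>

lemma riccati_eigenvalue_Re_neg:
  fixes A X :: "complex ^ 'n ^ 'n" and B :: "complex ^ 'm ^ 'n"
  assumes skew: "skew_hermitian A" and X: "nonneg_definite X" and ric: "lqr_riccati A B X"
    and w: "closed_loop A B X *v w = z *s w" "w \<noteq> 0"
  shows "Re z < 0"
proof -
  let ?y = "X *v w"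
  let ?b = "conj_transpose B *v ?y"
  let ?c = "cinner w ?y"
  note eqs = riccati_eigenvector[OF skew ric w(1)]
  have "cinner w w = cinner w (A *v ?y) - z * ?c"
    using arg_cong[OF eqs(1), of "cinner w"] by (simp add: cinner_diff_right cinner_scale_right)
  moreover have "cinner (A *v w) ?y = - cinner w (A *v ?y)"
    using skew by (simp add: cinner_adjoint skew_hermitian_def uminus_matrix_vector_mult
        cinner_minus_right)
  moreover have "cinner (A *v w) ?y = cinner ?b ?b + cnj z * ?c"
  proof -
    have "A *v w = B *v ?b + z *s w"
      using eqs(2) by (simp add: algebra_simps)
    then show ?thesis
      by (simp add: cinner_add_left cinner_scale_left cinner_adjoint)
  qed
  ultimately have "cinner w w + cinner ?b ?b = - ((z + cnj z) * ?c)"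
    by (simp add: algebra_simps)
  from arg_cong[OF this, of Re] have "(norm w)\<^sup>2 + (norm ?b)\<^sup>2 = - (2 * Re z * Re ?c)"
    by (simp add: cinner_self)
  moreover have "0 < (norm w)\<^sup>2 + (norm ?b)\<^sup>2"
    using w(2) by (simp add: add_pos_nonneg)
  ultimately have "Re z * Re ?c < 0"
    by simp
  moreover have "0 \<le> Re ?c"
    using X by (simp add: nonneg_definite_def)
  ultimately show ?thesis
    by (simp add: mult_less_0_iff)
qed

text \<open>The core estimate, for any index set W that carries the lower bound and outside which
  the modes stay \<open>\<Delta> / 2\<close> away from Im z. Of \<open>\<sigma>\<^sub>0\<close> only
  the factor \<open>4 * (K\<^sup>2 / \<gamma>\<^sup>2) + 1\<close> survives, in
  \<open>gap\<close>.\<close>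

lemma quadratic_eigenvalue_decay:
  fixes A :: "complex ^ 'n ^ 'n" and B :: "complex ^ 'm ^ 'n"
  assumes basis: "orthonormal_basis J v" and J: "finite J" "W \<subseteq> J"
    and eigen: "\<forall>j\<in>J. A *v v j = (\<i> * complex_of_real (l j)) *s v j"
    and y: "y \<noteq> 0" "A *v y - z *s y = w" "A *v w - z *s w = B *v (conj_transpose B *v y)" "Re z \<noteq> 0"
    and far: "\<And>j. j \<in> J - W \<Longrightarrow> \<Delta> / 2 \<le> \<bar>l j - Im z\<bar>"
    and pos: "0 < \<gamma>" "0 < K" "0 < \<Delta>"
    and lower: "\<And>d. d \<in> vec.span (v ` W) \<Longrightarrow> \<gamma> * norm d \<le> norm (conj_transpose B *v d)"
    and upper: "\<And>d. norm (conj_transpose B *v d) \<le> K * norm d"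
    and gap: "(2 * Re z)\<^sup>2 * (4 * (K\<^sup>2 / \<gamma>\<^sup>2) + 1) \<le> \<Delta>\<^sup>2"
  shows "\<gamma> \<le> 2 * \<bar>Re z\<bar>"
proof -
  define r where "r = Re z"
  have on: "\<forall>j\<in>J. \<forall>k\<in>J. cinner (v j) (v k) = (if j = k then 1 else 0)"
    using basis by (simp add: orthonormal_basis_def)
  have "y \<in> vec.span (v ` J)"
    using basis by (simp add: orthonormal_basis_def)
  then obtain c where c: "y = (\<Sum>j\<in>J. c j *s v j)"
    using span_image_sumE[OF J(1) orthonormal_basis_inj[OF basis]] by blast
  define p where "p = (\<Sum>j\<in>W. c j *s v j)"
  define q where "q = (\<Sum>j\<in>J - W. c j *s v j)"
  have y_eq: "y = p + q"
    unfolding c p_def q_def using J by (simp add: sum.subset_diff add.commute)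
  have fW: "finite W" using J finite_subset by blast
  have np: "(norm p)\<^sup>2 = (\<Sum>j\<in>W. (cmod (c j))\<^sup>2)"
    unfolding p_def using J fW by (intro norm_orthonormal_sum) (auto simp: on subset_iff)
  have nq: "(norm q)\<^sup>2 = (\<Sum>j\<in>J - W. (cmod (c j))\<^sup>2)"
    unfolding q_def using J by (intro norm_orthonormal_sum) (auto simp: on)
  define a where "a j = \<i> * complex_of_real (l j)" for j
  have eig: "\<forall>j\<in>J. A *v v j = a j *s v j"
    using eigen by (simp add: a_def)
  have w_eq: "w = (\<Sum>j\<in>J. ((a j - z) * c j) *s v j)"
    using y(2) shifted_apply_sum[OF eig, of c z] by (simp add: c)
  have BB: "B *v (conj_transpose B *v y) = (\<Sum>j\<in>J. ((a j - z) * ((a j - z) * c j)) *s v j)"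
    using y(3) shifted_apply_sum[OF eig, of "\<lambda>j. (a j - z) * c j" z] by (simp add: w_eq)
  let ?N = "norm (conj_transpose B *v y)"
  have "complex_of_real (?N\<^sup>2) = cinner y (B *v (conj_transpose B *v y))"
    by (metis cinner_adjoint cinner_self conj_transpose_conj_transpose)
  also have "\<dots> = (\<Sum>j\<in>J. cnj (c j) * ((a j - z) * ((a j - z) * c j)))"
    using cinner_orthonormal_sums[OF J(1) on, of c] unfolding BB c[symmetric] .
  also have "\<dots> = (\<Sum>j\<in>J. (a j - z)\<^sup>2 * of_real ((cmod (c j))\<^sup>2))"
    by (intro sum.cong refl, subst complex_norm_square) (simp add: power2_eq_square mult_ac)
  finally have "?N\<^sup>2 = Re (\<Sum>j\<in>J. (a j - z)\<^sup>2 * of_real ((cmod (c j))\<^sup>2))"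
    by (metis Re_complex_of_real)
  \<comment> \<open>Here a j - z = -r + i (l j - Im z), and the real part of its square is
    taken.\<close>
  also have "\<dots> = (\<Sum>j\<in>J. (r\<^sup>2 - (l j - Im z)\<^sup>2) * (cmod (c j))\<^sup>2)"
    by (simp add: a_def r_def power2_eq_square algebra_simps)
  also have "\<dots> = (\<Sum>j\<in>W. (r\<^sup>2 - (l j - Im z)\<^sup>2) * (cmod (c j))\<^sup>2)
      + (\<Sum>j\<in>J - W. (r\<^sup>2 - (l j - Im z)\<^sup>2) * (cmod (c j))\<^sup>2)"
    using J by (simp add: sum.subset_diff add.commute)
  also have "\<dots> \<le> (\<Sum>j\<in>W. r\<^sup>2 * (cmod (c j))\<^sup>2) + (\<Sum>j\<in>J - W. (r\<^sup>2 - (\<Delta> / 2)\<^sup>2) * (cmod (c j))\<^sup>2)"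
  proof (intro add_mono sum_mono mult_right_mono)
    fix j assume "j \<in> J - W"
    then have "(\<Delta> / 2)\<^sup>2 \<le> \<bar>l j - Im z\<bar>\<^sup>2"
      using far pos by (intro power_mono) auto
    then show "r\<^sup>2 - (l j - Im z)\<^sup>2 \<le> r\<^sup>2 - (\<Delta> / 2)\<^sup>2" by simp
  qed auto
  also have "\<dots> = r\<^sup>2 * (norm p)\<^sup>2 + (r\<^sup>2 - (\<Delta> / 2)\<^sup>2) * (norm q)\<^sup>2"
    by (simp add: np nq sum_distrib_left)
  also have "\<dots> \<le> r\<^sup>2 * (norm p)\<^sup>2 - r\<^sup>2 * (4 * (K\<^sup>2 / \<gamma>\<^sup>2)) * (norm q)\<^sup>2"
  proof -
    \<comment> \<open>This is \<open>gap\<close> divided by 4; the summand 1 there absorbs the r^2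
      on the left.\<close>
    have "r\<^sup>2 - (\<Delta> / 2)\<^sup>2 \<le> - (r\<^sup>2 * (4 * (K\<^sup>2 / \<gamma>\<^sup>2)))"
      using gap by (simp add: r_def power2_eq_square field_simps)
    from mult_right_mono[OF this, of "(norm q)\<^sup>2"] show ?thesis by simp
  qed
  finally have N: "?N\<^sup>2 \<le> r\<^sup>2 * (norm p)\<^sup>2 - r\<^sup>2 * (4 * (K\<^sup>2 / \<gamma>\<^sup>2)) * (norm q)\<^sup>2" .
  show ?thesis
  proof (rule ccontr)
    assume "\<not> ?thesis"
    then have r: "2 * \<bar>r\<bar> < \<gamma>" by (simp add: r_def)
    have lo: "\<gamma> * norm p - K * norm q \<le> ?N"
    proof -
      have "p \<in> vec.span (v ` W)"
        unfolding p_def by (intro vec.span_sum vec.span_scale vec.span_base) auto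
      then have "\<gamma> * norm p \<le> norm (conj_transpose B *v p)" by (rule lower)
      also have "\<dots> = norm (conj_transpose B *v y - conj_transpose B *v q)"
        by (simp add: y_eq vec.add)
      also have "\<dots> \<le> ?N + norm (conj_transpose B *v q)"
        by (rule norm_triangle_ineq4)
      also have "\<dots> \<le> ?N + K * norm q" using upper by simp
      finally show ?thesis by simp
    qed
    \<comment> \<open>The left side of \<open>N\<close> is a square, so its right side is
      nonnegative, and r^2 cancels because Re z is nonzero.\<close>
    have Kq: "2 * K * norm q \<le> \<gamma> * norm p"
    proof -
      have "r\<^sup>2 * (4 * (K\<^sup>2 / \<gamma>\<^sup>2) * (norm q)\<^sup>2) \<le> r\<^sup>2 * (norm p)\<^sup>2"
        using order_trans[OF zero_le_power2 N] by (simp add: mult.assoc)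
      then have "4 * (K\<^sup>2 / \<gamma>\<^sup>2) * (norm q)\<^sup>2 \<le> (norm p)\<^sup>2"
        by (rule mult_left_le_imp_le) (use y(4) in \<open>simp add: r_def\<close>)
      then have "(2 * K * norm q)\<^sup>2 \<le> (\<gamma> * norm p)\<^sup>2"
        using pos by (simp add: power_mult_distrib field_simps)
      then show ?thesis
        by (rule power2_le_imp_le) (use pos in simp)
    qed
    \<comment> \<open>If p vanished, \<open>Kq\<close> would make q vanish too, and then y =
      0.\<close>
    have "norm p \<noteq> 0"
      using Kq pos y(1) y_eq by (auto simp: mult_le_0_iff)
    then have p: "0 < norm p" by simp
    have "\<gamma> / 2 * norm p \<le> ?N" using lo Kq by simp
    then have "(\<gamma> / 2 * norm p)\<^sup>2 \<le> ?N\<^sup>2"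
      using pos by (intro power_mono) auto
    also have "\<dots> \<le> (\<bar>r\<bar> * norm p)\<^sup>2"
    proof -
      have "0 \<le> r\<^sup>2 * (4 * (K\<^sup>2 / \<gamma>\<^sup>2)) * (norm q)\<^sup>2" by simp
      then have "?N\<^sup>2 \<le> r\<^sup>2 * (norm p)\<^sup>2" using N by linarith
      then show ?thesis by (simp add: power_mult_distrib)
    qed
    finally have "\<gamma> / 2 * norm p \<le> \<bar>r\<bar> * norm p"
      by (rule power2_le_imp_le) simp
    with p r show False by simp
  qed
qed

section \<open>Stabilizability and the spectral gap\<close>

text \<open>Otherwise M - z is onto, so d = (M - z) x for some x; but the left eigenvector d is
  orthogonal to the range of M - z, hence to itself.\<close>

lemma left_eigenvector_imp_eigenvalue:
  fixes M :: "complex ^ 'n ^ 'n"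
  assumes "d \<noteq> 0" "conj_transpose M *v d = cnj z *s d"
  shows "matrix_eigenvalue M z"
proof (rule ccontr)
  assume no: "\<not> matrix_eigenvalue M z"
  let ?T = "M - mat z"
  have T: "?T *v x = M *v x - z *s x" for x
    by (simp add: matrix_vector_mult_diff_rdistrib mat_matrix_vector_mult)
  have "\<forall>x. ?T *v x = 0 \<longrightarrow> x = 0"
    using no unfolding matrix_eigenvalue_def T by auto
  then have "surj ((*v) ?T)"
    using matrix_left_invertible_ker matrix_right_invertible_surjective matrix_left_right_inverse
    by metis
  then obtain x where "?T *v x = d"
    by (metis surjD)
  then have "cinner d d = cinner d (M *v x) - z * cinner d x"
    unfolding T by (metis cinner_diff_right cinner_scale_right)
  also have "cinner d (M *v x) = z * cinner d x"
    using cinner_adjoint[of "conj_transpose M" d x] assms(2) by (simp add: cinner_scale_left)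
  finally show False
    using assms(1) by (simp add: cinner_self)
qed

text \<open>One direction of the Hautus test: a nonzero d would be a left eigenvector of A + B F for
  every feedback F, with an eigenvalue on the imaginary axis.\<close>

lemma stabilizable_skew_kernel:
  fixes A :: "complex ^ 'n ^ 'n" and B :: "complex ^ 'm ^ 'n"
  assumes "skew_hermitian A" "stabilizable A B"
    and d: "A *v d = (\<i> * complex_of_real t) *s d" "conj_transpose B *v d = 0"
  shows "d = 0"
proof (rule ccontr)
  assume "d \<noteq> 0"
  obtain F where F: "stable (A + B ** F)"
    using assms(2) by (auto simp: stabilizable_def)
  have "conj_transpose (A + B ** F) = - A + conj_transpose F ** conj_transpose B"
    using assms(1) by (simp add: skew_hermitian_def vec_eq_iff matrix_matrix_mult_def mult.commute)
  then have "conj_transpose (A + B ** F) *v d = cnj (\<i> * complex_of_real t) *s d"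
    using d by (simp add: matrix_vector_mult_diff_rdistrib flip: matrix_vector_mul_assoc)
  then have "matrix_eigenvalue (A + B ** F) (\<i> * complex_of_real t)"
    by (rule left_eigenvector_imp_eigenvalue[OF \<open>d \<noteq> 0\<close>])
  then show False
    using F by (auto simp: stable_def)
qed

text \<open>An eigenspace of dimension greater than the number of inputs meets \<open>ker B\<^sup>*\<close>.\<close>

lemma eig_gap_pos:
  fixes A :: "complex ^ 'n ^ 'n" and B :: "complex ^ 'm ^ 'n"
  assumes n: "n = CARD('n)" and m: "m = CARD('m)" "m < n"
    and skew: "skew_hermitian A" and stab: "stabilizable A B"
    and basis: "orthonormal_basis {1..n} v"
    and eigen: "\<forall>j\<in>{1..n}. A *v v j = (\<i> * complex_of_real (l j)) *s v j"
    and ordered: "\<forall>j\<in>{1..n}. \<forall>k\<in>{1..n}. j \<le> k \<longrightarrow> l j \<le> l k"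
  shows "0 < eig_gap n m l"
proof -
  have "l (j + m) \<noteq> l j" if j: "j \<in> {1..n - m}" for j
  proof
    assume eq: "l (j + m) = l j"
    let ?W = "{j..j + m}"
    have W: "?W \<subseteq> {1..n}" using j by auto
    \<comment> \<open>Equal end values and monotonicity force all m + 1 eigenvalues of the window to
      coincide.\<close>
    have le: "l i = l j" if "i \<in> ?W" for i
    proof (rule antisym)
      have "{j, i, j + m} \<subseteq> {1..n}" "j \<le> i" "i \<le> j + m" using that W by auto
      then show "l i \<le> l j" "l j \<le> l i"
        using ordered[rule_format, of i "j + m"] ordered[rule_format, of j i] eq by auto
    qed
    have "vec.independent (v ` ?W)"
      using orthonormal_basis_independent basis W unfolding n by (meson image_mono vec.independent_mono)
    then have "vec.dim (v ` ?W) = card (v ` ?W)"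
      by (rule vec.dim_eq_card_independent)
    also have "\<dots> = Suc m"
      using inj_on_subset[OF orthonormal_basis_inj[OF basis] W] by (simp add: card_image)
    finally have dim: "vec.dim (v ` ?W) = Suc m" .
    have "\<not> inj_on ((*v) (conj_transpose B)) (vec.span (v ` ?W))"
    proof
      assume "inj_on ((*v) (conj_transpose B)) (vec.span (v ` ?W))"
      then have "vec.dim ((*v) (conj_transpose B) ` v ` ?W) = Suc m"
        using vec.dim_image_eq[OF matrix_vector_mul_linear_gen] dim by metis
      then show False
        using vec.dim_subset_UNIV[of "(*v) (conj_transpose B) ` v ` ?W"] m(1)
        by (simp add: vec.dimension_def card_cart_basis)
    qed
    then obtain x y where xy: "x \<in> vec.span (v ` ?W)" "y \<in> vec.span (v ` ?W)" "x \<noteq> y"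
      "conj_transpose B *v x = conj_transpose B *v y"
      by (auto simp: inj_on_def)
    have "vec.subspace {d. A *v d = (\<i> * complex_of_real (l j)) *s d}"
      by (auto simp: vec.subspace_def vec.add vec.scale vec.scale_right_distrib mult.commute)
    moreover have "v ` ?W \<subseteq> {d. A *v d = (\<i> * complex_of_real (l j)) *s d}"
    proof (intro image_subsetI CollectI)
      fix i assume "i \<in> ?W"
      with W le eigen show "A *v v i = (\<i> * complex_of_real (l j)) *s v i" by (metis subsetD)
    qed
    ultimately have "vec.span (v ` ?W) \<subseteq> {d. A *v d = (\<i> * complex_of_real (l j)) *s d}"
      by (intro vec.span_minimal)
    then have "A *v (x - y) = (\<i> * complex_of_real (l j)) *s (x - y)"
      using vec.span_diff[OF xy(1,2)] by blast
    moreover have "conj_transpose B *v (x - y) = 0"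
      using xy(4) by (simp add: vec.diff)
    ultimately have "x - y = 0"
      by (rule stabilizable_skew_kernel[OF skew stab])
    then show False using xy(3) by simp
  qed
  then show ?thesis
    using m(2) by (auto simp: eig_gap_def)
qed

text \<open>Two indices of modes closer than \<open>eig_gap n m l / 2\<close> to \<open>s\<close> differ by less than \<open>m\<close>.\<close>

lemma near_modes_window:
  assumes m: "1 \<le> m" "m < n"
    and ordered: "\<forall>j\<in>{1..n}. \<forall>k\<in>{1..n}. j \<le> k \<longrightarrow> l j \<le> l k"
  obtains k where "k \<in> {1..n - m + 1}"
    and "\<And>j. j \<in> {1..n} - {k..k + m - 1} \<Longrightarrow> eig_gap n m l / 2 \<le> \<bar>l j - s\<bar>"
proof -
  let ?D = "eig_gap n m l"
  define N where "N = {j \<in> {1..n}. \<bar>l j - s\<bar> < ?D / 2}"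
  \<comment> \<open>The window starts at the first near mode, or further left if it would otherwise
    run past n. With no near mode any window works.\<close>
  define k where "k = (if N = {} then 1 else min (Min N) (n - m + 1))"
  have fin: "finite N" by (simp add: N_def)
  have k: "k \<in> {1..n - m + 1}"
  proof (cases "N = {}")
    case False
    then have "Min N \<in> N" using fin by simp
    then show ?thesis using False by (auto simp: k_def N_def)
  qed (use m in \<open>auto simp: k_def\<close>)
  have "N \<subseteq> {k..k + m - 1}"
  proof
    fix j assume j: "j \<in> N"
    then have ne: "N \<noteq> {}" by auto
    define i where "i = Min N"
    have i: "i \<in> N" "i \<le> j" using fin ne j by (auto simp: i_def)
    have ik: "k = min i (n - m + 1)" using ne by (simp add: k_def i_def)
    \<comment> \<open>Otherwise l i and l j are at least \<open>?D\<close> apart, yet both lie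
      strictly within \<open>?D / 2\<close> of s.\<close>
    have "j < i + m"
    proof (rule ccontr)
      assume "\<not> j < i + m"
      then have ij: "i + m \<le> j" by simp
      have jn: "i \<in> {1..n}" "j \<in> {1..n}" using i j by (auto simp: N_def)
      then have "i \<in> {1..n - m}" using ij by auto
      then have "?D \<le> \<bar>l (i + m) - l i\<bar>"
        unfolding eig_gap_def by (intro Min_le) auto
      moreover have "l i \<le> l (i + m)" "l (i + m) \<le> l j"
        using ordered ij jn by auto
      moreover have "\<bar>l i - s\<bar> < ?D / 2" "\<bar>l j - s\<bar> < ?D / 2"
        using i j by (auto simp: N_def)
      ultimately show False by linarith
    qed
    moreover have "j \<le> n" using j by (auto simp: N_def)
    ultimately show "j \<in> {k..k + m - 1}" using i m by (auto simp: ik min_def)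
  qed
  then show ?thesis
    using k by (intro that[of k]) (auto simp: N_def not_less[symmetric])
qed

section \<open>Bounds for the maximizer and the two terms of the decay rate\<close>

text \<open>The denominator is at least x + x^2 and the numerator is below x. The first bound gives
  mu < 1, the second the decay needed for a maximum to exist.\<close>

lemma f_quot_le:
  assumes "1 \<le> m" "0 < \<theta>" "\<theta> < x"
  shows "f_quot m \<theta> x < 1" "f_quot m \<theta> x \<le> 1 / x"
proof -
  have "x + x\<^sup>2 = (\<Sum>i\<in>{1, 2}. x ^ i)" by simp
  also have "\<dots> \<le> (\<Sum>i = 1..m + 1. x ^ i)"
    using assms by (intro sum_mono2) auto
  finally have S: "x + x\<^sup>2 \<le> (\<Sum>i = 1..m + 1. x ^ i)" .
  have x: "0 < x" "0 < x\<^sup>2" using assms by auto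
  have "f_quot m \<theta> x < 1"
    unfolding f_quot_def using S x assms by (subst divide_less_eq_1_pos) linarith+
  moreover have "f_quot m \<theta> x \<le> x / x\<^sup>2"
    unfolding f_quot_def using S x assms by (intro frac_le) linarith+
  ultimately show "f_quot m \<theta> x < 1" "f_quot m \<theta> x \<le> 1 / x"
    using x by (simp_all add: power2_eq_square)
qed

lemma f_quot_pos:
  assumes "0 < \<theta>" "\<theta> < x"
  shows "0 < f_quot m \<theta> x"
  unfolding f_quot_def using assms by (intro divide_pos_pos sum_pos) auto

text \<open>\<open>sigma0\<close> is a choice of maximizer, so one must be exhibited: a compact
  interval contains a maximizer, and beyond it the bound 1 / x keeps the function below a value
  already reached.\<close>

lemma sigma0_gt:
  assumes "1 \<le> m" "0 < \<theta>"
  shows "\<theta> < sigma0 m \<theta>"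
proof -
  let ?f = "f_quot m \<theta>"
  define c where "c = ?f (\<theta> + 1)"
  have c: "0 < c" unfolding c_def using assms by (intro f_quot_pos) auto
  \<comment> \<open>The first entry keeps the comparison point in the interval; past the second, 1 /
    y <= c.\<close>
  define R where "R = max (\<theta> + 1) (1 / c)"
  have S: "(\<Sum>i = 1..m + 1. x ^ i) \<noteq> 0" if "x \<in> {\<theta>..R}" for x
    using that assms by (intro less_imp_neq[symmetric] sum_pos) auto
  have "continuous_on {\<theta>..R} ?f"
    unfolding f_quot_def using S by (intro continuous_intros) blast
  then obtain x where x: "x \<in> {\<theta>..R}" "\<And>y. y \<in> {\<theta>..R} \<Longrightarrow> ?f y \<le> ?f x"
    using continuous_attains_sup[of "{\<theta>..R}" ?f] by (force simp: R_def)
  have cx: "c \<le> ?f x" unfolding c_def by (intro x(2)) (auto simp: R_def)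
  have "x \<noteq> \<theta>"
    using c cx by (auto simp: f_quot_def)
  then have x\<theta>: "\<theta> < x" using x(1) by simp
  have "is_arg_max ?f (\<lambda>x. x \<in> {\<theta><..}) x"
    unfolding is_arg_max_linorder
  proof (intro conjI allI impI)
    fix y assume y: "y \<in> {\<theta><..}"
    show "?f y \<le> ?f x"
    proof (cases "y \<le> R")
      case True
      then show ?thesis using x(2) y by simp
    next
      case False
      then have "1 / c \<le> y" by (simp add: R_def)
      then have "1 / y \<le> c" using c y assms by (simp add: field_simps)
      then show ?thesis using f_quot_le(2)[of m \<theta> y] y assms cx by simp
    qed
  qed (use x\<theta> in simp)
  then have "is_arg_max ?f (\<lambda>x. x \<in> {\<theta><..}) (sigma0 m \<theta>)"
    unfolding sigma0_def arg_max_on_def arg_max_def by (rule someI)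
  then show ?thesis by (simp add: is_arg_max_def)
qed

text \<open>As m >= 2, the geometric sum contains 1 + \<open>\<sigma>\<close> +
  \<open>\<sigma>\<close>^2, which is at least 1 + 2 \<open>\<sigma>\<close> since
  \<open>\<sigma>\<close> > 1.\<close>

lemma geometric_quotient_ge:
  fixes \<sigma> :: real
  assumes "2 \<le> m" "1 \<le> \<theta>" "\<theta> < \<sigma>"
  shows "4 * \<theta> + 1 \<le> 2 * ((\<sigma> ^ (m + 1) - 1) / (\<sigma> - 1)) - 1"
proof -
  have "1 + \<sigma> + \<sigma>\<^sup>2 = (\<Sum>i<3. \<sigma> ^ i)" by (simp add: eval_nat_numeral)
  also have "\<dots> \<le> (\<Sum>i<m + 1. \<sigma> ^ i)"
    using assms by (intro sum_mono2) auto
  also have "\<dots> = (\<sigma> ^ (m + 1) - 1) / (\<sigma> - 1)"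
    using assms by (intro geometric_sum) auto
  finally have "1 + \<sigma> + \<sigma>\<^sup>2 \<le> (\<sigma> ^ (m + 1) - 1) / (\<sigma> - 1)" .
  moreover have "\<sigma> \<le> \<sigma>\<^sup>2"
    using assms by (simp add: power2_eq_square)
  ultimately show ?thesis using assms by linarith
qed

section \<open>Assembly of the eigenvalue bound\<close>

theorem theorem14:
  fixes A X :: "complex ^ 'n ^ 'n"
    and B :: "complex ^ 'm ^ 'n"
    and v :: "nat \<Rightarrow> complex ^ 'n"
    and l :: "nat \<Rightarrow> real"
    and Proj :: "nat \<Rightarrow> complex ^ 'n \<Rightarrow> complex ^ 'n"
    and n m :: nat
    and \<gamma> K \<Delta> \<sigma>\<^sub>0 \<rho> :: real
  assumes n: "n = CARD('n)"
    and m: "m = CARD('m)"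
    and dims: "2 \<le> m" "m < n"
    and skew: "skew_hermitian A"
    and basis: "orthonormal_basis {1..n} v"
    and eigen: "\<forall>j\<in>{1..n}. A *v v j = (\<i> * complex_of_real (l j)) *s v j"
    and ordered: "\<forall>j\<in>{1..n}. \<forall>k\<in>{1..n}. j \<le> k \<longrightarrow> l j \<le> l k"
    and ker: "{u. B *v u = 0} = {0}"
    and stabilizable: "stabilizable A B"
    and proj: "\<forall>k\<in>{1..n - m + 1}. Proj k = orth_proj (vec.span (v ` {k..k + m - 1}))"
    and pos: "0 < \<gamma>" "0 < K"
    and normB: "onorm ((*v) B) \<le> K"
    and lower: "\<forall>k\<in>{1..n - m + 1}. \<forall>d. norm (conj_transpose B *v Proj k d) \<ge> \<gamma> * norm (Proj k d)"
    and gap: "\<Delta> = eig_gap n m l"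
    and sigma: "\<sigma>\<^sub>0 = sigma0 m (K\<^sup>2 / \<gamma>\<^sup>2)"
    and rho: "\<rho> = 1 / 2 * min (\<Delta> * (2 * ((\<sigma>\<^sub>0 ^ (m + 1) - 1) / (\<sigma>\<^sub>0 - 1)) - 1) powr (- 1 / 2))
                             (\<gamma> * mu m (K\<^sup>2 / \<gamma>\<^sup>2) powr (1 / 2))"
    and riccati: "nonneg_definite X" "lqr_riccati A B X"
  shows "(\<forall>z. matrix_eigenvalue (closed_loop A B X) z \<longrightarrow> Re z \<le> - \<rho>) \<and> - \<rho> < 0"
proof -
  define \<theta> where "\<theta> = K\<^sup>2 / \<gamma>\<^sup>2"
  define E where "E = 2 * ((\<sigma>\<^sub>0 ^ (m + 1) - 1) / (\<sigma>\<^sub>0 - 1)) - 1"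
  have low: "\<gamma> * norm d \<le> norm (conj_transpose B *v d)"
    if "k \<in> {1..n - m + 1}" "d \<in> vec.span (v ` {k..k + m - 1})" for k d
    using lower[rule_format, of k d] proj that orth_proj_fixes[OF vec.subspace_span that(2)] by simp
  have up: "norm (conj_transpose B *v d) \<le> K * norm d" for d
    by (rule norm_conj_transpose_mult_le[OF normB])
  \<comment> \<open>Both bounds are tested on the unit vector v 1, which lies in the first
    window.\<close>
  have "\<gamma> \<le> K"
  proof -
    have "(norm (v 1))\<^sup>2 = 1"
      using norm_orthonormal_sum[of "{1}" v "\<lambda>_. 1"] basis dims
      by (simp add: orthonormal_basis_def )
    then have "norm (v 1) = 1"
      by (simp add: norm_eq_1 power2_norm_eq_inner)
    moreover have "v 1 \<in> vec.span (v ` {1..1 + m - 1})"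
      using dims by (intro vec.span_base) auto
    ultimately show ?thesis
      using low[of 1 "v 1"] up[of "v 1"] by simp
  qed
  then have \<theta>: "1 \<le> \<theta>"
    using pos by (simp add: \<theta>_def)
  have \<sigma>: "\<theta> < \<sigma>\<^sub>0"
    unfolding sigma \<theta>_def[symmetric] using \<theta> dims by (intro sigma0_gt) auto
  have E: "4 * \<theta> + 1 \<le> E"
    unfolding E_def by (rule geometric_quotient_ge[OF dims(1) \<theta> \<sigma>])
  have E0: "0 < E" using E \<theta> by linarith
  have mu: "0 < mu m \<theta>" "mu m \<theta> < 1"
    using f_quot_pos[of \<theta> \<sigma>\<^sub>0 m] f_quot_le(1)[of m \<theta> \<sigma>\<^sub>0] \<theta> \<sigma> dims
    by (auto simp: mu_def sigma \<theta>_def)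
  have \<Delta>: "0 < \<Delta>"
    unfolding gap by (rule eig_gap_pos[OF n m dims(2) skew stabilizable basis eigen ordered])
  have rho': "2 * \<rho> = min (\<Delta> / sqrt E) (\<gamma> * sqrt (mu m \<theta>))"
    using E0 mu by (simp add: rho E_def \<theta>_def powr_minus_divide powr_half_sqrt)
  have "0 < 2 * \<rho>"
    unfolding rho' using \<Delta> E0 mu pos by simp
  then have \<rho>: "0 < \<rho>" by simp
  have "Re z \<le> - \<rho>" if ev: "matrix_eigenvalue (closed_loop A B X) z" for z
  proof (rule ccontr)
    assume "\<not> Re z \<le> - \<rho>"
    then have less: "- Re z < \<rho>" by simp
    obtain w where w: "w \<noteq> 0" "closed_loop A B X *v w = z *s w"
      using ev by (auto simp: matrix_eigenvalue_def)
    note eqs = riccati_eigenvector[OF skew riccati(2) w(2)]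
    have neg: "Re z < 0"
      by (rule riccati_eigenvalue_Re_neg[OF skew riccati w(2,1)])
    have y: "X *v w \<noteq> 0" using eqs(1) w(1) by auto
    have "\<bar>2 * Re z\<bar> \<le> \<Delta> / sqrt E"
      using less neg rho' by simp
    then have "\<bar>2 * Re z\<bar> * sqrt E \<le> \<Delta>"
      using E0 by (simp add: field_simps)
    then have "(\<bar>2 * Re z\<bar> * sqrt E)\<^sup>2 \<le> \<Delta>\<^sup>2"
      using E0 by (intro power_mono) auto
    then have "(2 * Re z)\<^sup>2 * E \<le> \<Delta>\<^sup>2"
      using E0 by (simp add: power_mult_distrib)
    with mult_left_mono[OF E, of "(2 * Re z)\<^sup>2"]
    have gapE: "(2 * Re z)\<^sup>2 * (4 * (K\<^sup>2 / \<gamma>\<^sup>2) + 1) \<le> \<Delta>\<^sup>2"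
      unfolding \<theta>_def by simp
    obtain k where k: "k \<in> {1..n - m + 1}"
      and far: "\<And>j. j \<in> {1..n} - {k..k + m - 1} \<Longrightarrow> \<Delta> / 2 \<le> \<bar>l j - Im z\<bar>"
      using near_modes_window[of m n l "Im z"] dims ordered unfolding gap by auto
    have "{k..k + m - 1} \<subseteq> {1..n}" using k dims by auto
    then have "\<gamma> \<le> 2 * \<bar>Re z\<bar>"
      by (intro quadratic_eigenvalue_decay[OF basis finite_atLeastAtMost _ eigen y eqs
            neg[THEN less_imp_neq] far pos \<Delta> low[OF k] up gapE])
    \<comment> \<open>Strictness closes the argument: 2 |Re z| < 2 \<open>\<rho>\<close> <
      \<open>\<gamma>\<close> contradicts the core estimate.\<close>
    moreover have "\<gamma> * sqrt (mu m \<theta>) < \<gamma>"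
      using mu pos by simp
    ultimately show False using less neg rho' by linarith
  qed
  with \<rho> show ?thesis by simp
qed

end
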